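(* Let $n\in\mathbb N$ and $J:=\{\alpha\in IF_n:\mathrm{rank}\,\alpha\ge n-2\}$. Then $IF_n=\langle J\rangle$.
   Context: $\mathbb N=\{1,2,3,\dots\}$. $X_n=\{1,\dots,n\}$ carries the fence (zigzag) partial order $1<_f 2>_f 3<_f\cdots n$ (the only strict relations are between consecutive integers; odd numbers are minimal, even numbers are maximal). $I_n$ is the symmetric inverse semigroup of all partial injective maps on $X_n$; maps are written on the right and composed left to right. $IF_n$ is the inverse subsemigroup of all $\alpha\in I_n$ such that for all $x,y\in\mathrm{dom}\,\alpha$: $x<_f y$ if and only if $x\alpha<_f y\alpha$. $\mathrm{rank}\,\alpha=|\mathrm{im}\,\alpha|$. $\langle A\rangle$ is the subsemigroup of $I_n$ generated by $A$. *)

theory Defs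
  imports Main
begin

text \<open>The strict part of the fence order \<open>1 < 2 > 3 < \<dots> n\<close> on \<open>{1..n}\<close>: the strict relations are
  exactly those between consecutive integers, with the even one on top.\<close>

definition fence_less :: "nat \<Rightarrow> nat \<Rightarrow> nat \<Rightarrow> bool" where
  "fence_less n x y \<longleftrightarrow>
     x \<in> {1..n} \<and> y \<in> {1..n} \<and> even y \<and> (y = x + 1 \<or> x = y + 1)"

definition sym_inv :: "nat \<Rightarrow> (nat \<rightharpoonup> nat) set" where
  "sym_inv n = {\<alpha>. dom \<alpha> \<subseteq> {1..n} \<and> ran \<alpha> \<subseteq> {1..n} \<and> inj_on \<alpha> (dom \<alpha>)}"

text \<open>Maps act on the right, so the product \<open>\<alpha> \<beta>\<close> applies \<open>\<alpha>\<close> first.\<close>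

definition pmult :: "(nat \<rightharpoonup> nat) \<Rightarrow> (nat \<rightharpoonup> nat) \<Rightarrow> (nat \<rightharpoonup> nat)"  (infixl "\<cdot>\<^sub>p" 70) where
  "\<alpha> \<cdot>\<^sub>p \<beta> = \<beta> \<circ>\<^sub>m \<alpha>"

definition rank :: "(nat \<rightharpoonup> nat) \<Rightarrow> nat" where
  "rank \<alpha> = card (ran \<alpha>)"

definition IF :: "nat \<Rightarrow> (nat \<rightharpoonup> nat) set" where
  "IF n = {\<alpha> \<in> sym_inv n. \<forall>x \<in> dom \<alpha>. \<forall>y \<in> dom \<alpha>.
     fence_less n x y \<longleftrightarrow> fence_less n (the (\<alpha> x)) (the (\<alpha> y))}"

text \<open>The generated subsemigroup: nonempty finite products only, no identity is adjoined.\<close>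

inductive_set semigroup_gen :: "(nat \<rightharpoonup> nat) set \<Rightarrow> (nat \<rightharpoonup> nat) set"
  for A :: "(nat \<rightharpoonup> nat) set" where
  base: "\<alpha> \<in> A \<Longrightarrow> \<alpha> \<in> semigroup_gen A"
| mult: "\<alpha> \<in> semigroup_gen A \<Longrightarrow> \<beta> \<in> semigroup_gen A \<Longrightarrow> \<alpha> \<cdot>\<^sub>p \<beta> \<in> semigroup_gen A"

end

theory Submission
  imports Defs
begin

text \<open>Call the points outside \<open>A\<close>, together with \<open>0\<close> and \<open>n + 1\<close>, the separators of \<open>A\<close>.  Two kinds of
  maps of rank at least \<open>n - 2\<close> suffice: reversing the block between two separators of equal parity,
  and moving an isolated point to position \<open>1\<close> while the points before it move two places up.
  Given an isomorphism \<open>A \<rightarrow> B\<close> that is the identity below a separator \<open>s\<close>, the first maximal run of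
  \<open>A\<close> beyond \<open>s\<close> is carried to a run of \<open>B\<close>, which the moves bring back to the place just after \<open>s\<close>.
  If it then arrives reversed, its length is odd, so one more reversal makes the map the identity up
  to the next separator.\<close>

section \<open>Partial isomorphisms as total functions restricted to a domain\<close>

definition full_map :: "(nat \<Rightarrow> nat) \<Rightarrow> nat set \<Rightarrow> (nat \<rightharpoonup> nat)" where
  "full_map f A = (\<lambda>x. if x \<in> A then Some (f x) else None)"

definition IF_top :: "nat \<Rightarrow> (nat \<rightharpoonup> nat) set" where
  "IF_top n = {\<alpha> \<in> IF n. int (rank \<alpha>) \<ge> int n - 2}"

text \<open>Total functions \<open>f\<close> and \<open>g\<close> with explicit sets stand for a
  partial map and its inverse, so products become compositions; only the values on \<open>A\<close>
  and \<open>B\<close> matter.\<close>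

definition fence_iso :: "nat \<Rightarrow> nat set \<Rightarrow> (nat \<Rightarrow> nat) \<Rightarrow> (nat \<Rightarrow> nat) \<Rightarrow> nat set \<Rightarrow> bool" where
  "fence_iso n A f g B \<longleftrightarrow> A \<subseteq> {1..n} \<and> B \<subseteq> {1..n} \<and> f ` A = B \<and> (\<forall>x\<in>A. g (f x) = x) \<and>
     (\<forall>x\<in>A. \<forall>y\<in>A. fence_less n x y \<longleftrightarrow> fence_less n (f x) (f y))"

text \<open>Both directions are recorded because a generated subsemigroup is not visibly closed
  under inverses, while the induction swaps a map with its inverse.\<close>

definition generated_iso :: "nat \<Rightarrow> nat set \<Rightarrow> (nat \<Rightarrow> nat) \<Rightarrow> (nat \<Rightarrow> nat) \<Rightarrow> nat set \<Rightarrow> bool" where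
  "generated_iso n A f g B \<longleftrightarrow> fence_iso n A f g B \<and>
     full_map f A \<in> semigroup_gen (IF_top n) \<and> full_map g B \<in> semigroup_gen (IF_top n)"

lemma dom_full_map [simp]: "dom (full_map f A) = A"
  by (auto simp: full_map_def dom_def)

lemma ran_full_map [simp]: "ran (full_map f A) = f ` A"
  by (auto simp: full_map_def ran_def)

lemma full_map_cong: "(\<And>x. x \<in> A \<Longrightarrow> f x = g x) \<Longrightarrow> full_map f A = full_map g A"
  by (auto simp: full_map_def)

lemma pmult_full_map: "f ` A \<subseteq> B \<Longrightarrow> full_map f A \<cdot>\<^sub>p full_map g B = full_map (g \<circ> f) A"
  by (force simp: full_map_def pmult_def map_comp_def)

lemma fence_isoD:
  assumes "fence_iso n A f g B"
  shows "A \<subseteq> {1..n}" "B \<subseteq> {1..n}" "f ` A = B" "\<And>x. x \<in> A \<Longrightarrow> g (f x) = x"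
    "\<And>x y. x \<in> A \<Longrightarrow> y \<in> A \<Longrightarrow> fence_less n (f x) (f y) \<longleftrightarrow> fence_less n x y"
  using assms unfolding fence_iso_def by blast+

lemma fence_iso_sym:
  assumes "fence_iso n A f g B"
  shows "fence_iso n B g f A"
proof -
  note D = fence_isoD[OF assms]
  have "g ` B = A" unfolding D(3)[symmetric] using D(4) by (simp add: image_image)
  then show ?thesis
    unfolding fence_iso_def using D(1,2) by (simp flip: D(3) add: D(4,5))
qed

lemma fence_iso_trans:
  assumes "fence_iso n A f g B" "fence_iso n B h k C"
  shows "fence_iso n A (h \<circ> f) (g \<circ> k) C"
proof -
  note D = fence_isoD[OF assms(1)] and E = fence_isoD[OF assms(2)]
  have "f x \<in> B" if "x \<in> A" for x using that D(3) by blast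
  then show ?thesis
    unfolding fence_iso_def using D(1) E(2) by (simp add: D(3-5) E(3-5) flip: image_image[of h f])
qed

lemma fence_iso_in_IF:
  assumes "fence_iso n A f g B"
  shows "full_map f A \<in> IF n"
proof -
  have "inj_on f A" using assms unfolding fence_iso_def by (metis inj_on_inverseI)
  then have "inj_on (full_map f A) A" by (simp add: inj_on_def full_map_def)
  moreover have "the (full_map f A x) = f x" if "x \<in> A" for x
    using that by (simp add: full_map_def)
  ultimately show ?thesis
    using assms unfolding fence_iso_def IF_def sym_inv_def by simp
qed

section \<open>Closure of \<open>IF n\<close> under products\<close>

lemma IF_pmult:
  assumes "\<alpha> \<in> IF n" "\<beta> \<in> IF n"
  shows "\<alpha> \<cdot>\<^sub>p \<beta> \<in> IF n"
proof -
  have *: "x \<in> dom (\<alpha> \<cdot>\<^sub>p \<beta>) \<longleftrightarrow> x \<in> dom \<alpha> \<and> the (\<alpha> x) \<in> dom \<beta>" for x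
    by (auto simp: pmult_def map_comp_def dom_def split: option.splits)
  have **: "x \<in> dom (\<alpha> \<cdot>\<^sub>p \<beta>) \<Longrightarrow> (\<alpha> \<cdot>\<^sub>p \<beta>) x = \<beta> (the (\<alpha> x))" for x
    by (auto simp: pmult_def map_comp_def dom_def split: option.splits)
  have "ran (\<alpha> \<cdot>\<^sub>p \<beta>) \<subseteq> ran \<beta>"
    by (auto simp: pmult_def map_comp_def ran_def split: option.splits)
  moreover have "inj_on (\<alpha> \<cdot>\<^sub>p \<beta>) (dom (\<alpha> \<cdot>\<^sub>p \<beta>))"
  proof (rule inj_onI)
    fix x y assume "x \<in> dom (\<alpha> \<cdot>\<^sub>p \<beta>)" "y \<in> dom (\<alpha> \<cdot>\<^sub>p \<beta>)" "(\<alpha> \<cdot>\<^sub>p \<beta>) x = (\<alpha> \<cdot>\<^sub>p \<beta>) y"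
    with * ** have "x \<in> dom \<alpha>" "y \<in> dom \<alpha>" "the (\<alpha> x) \<in> dom \<beta>" "the (\<alpha> y) \<in> dom \<beta>"
      "\<beta> (the (\<alpha> x)) = \<beta> (the (\<alpha> y))" by auto
    moreover from this have "the (\<alpha> x) = the (\<alpha> y)"
      using assms(2) unfolding IF_def sym_inv_def by (auto dest: inj_onD)
    ultimately show "x = y"
      using assms(1) unfolding IF_def sym_inv_def by (metis (no_types, lifting) domD inj_onD mem_Collect_eq option.sel)
  qed
  moreover have "dom (\<alpha> \<cdot>\<^sub>p \<beta>) \<subseteq> dom \<alpha>" using * by blast
  ultimately show ?thesis
    using assms unfolding IF_def sym_inv_def by (simp add: * **) (meson order_trans)
qed

lemma semigroup_gen_IF_top_subset: "semigroup_gen (IF_top n) \<subseteq> IF n"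
proof
  fix \<alpha> assume "\<alpha> \<in> semigroup_gen (IF_top n)"
  then show "\<alpha> \<in> IF n"
    by induction (auto simp: IF_top_def IF_pmult)
qed

section \<open>Isomorphisms that are products of maps of high rank\<close>

lemma fence_iso_top:
  assumes "fence_iso n A f g B" "int (card A) \<ge> int n - 2"
  shows "full_map f A \<in> semigroup_gen (IF_top n)"
proof -
  have "card (f ` A) = card A"
    using assms(1) unfolding fence_iso_def by (metis card_image inj_on_inverseI)
  with assms fence_iso_in_IF[OF assms(1)] show ?thesis
    by (intro semigroup_gen.base) (simp add: IF_top_def rank_def)
qed

lemma fence_iso_id: "A \<subseteq> {1..n} \<Longrightarrow> fence_iso n A id id A"
  by (auto simp: fence_iso_def)

text \<open>A partial identity is a product of identities omitting one point each; these have rank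
  \<open>n - 1\<close>, and the full identity, of rank \<open>n\<close>, starts the product.\<close>

lemma full_map_id_generated:
  assumes "A \<subseteq> {1..n}"
  shows "full_map id A \<in> semigroup_gen (IF_top n)"
proof -
  have "full_map id ({1..n} - F) \<in> semigroup_gen (IF_top n)" if "finite F" "F \<subseteq> {1..n}" for F
    using that
  proof (induction F)
    case empty
    show ?case by (rule fence_iso_top[OF fence_iso_id]) auto
  next
    case (insert x F)
    have "full_map id ({1..n} - {x}) \<in> semigroup_gen (IF_top n)"
      using insert.prems by (intro fence_iso_top[OF fence_iso_id]) auto
    moreover have "full_map id ({1..n} - insert x F) =
        full_map id ({1..n} - F) \<cdot>\<^sub>p full_map id ({1..n} - {x})"
      by (rule ext) (simp add: full_map_def pmult_def map_comp_def)
    moreover have "full_map id ({1..n} - F) \<in> semigroup_gen (IF_top n)"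
      using insert by blast
    ultimately show ?case by (metis semigroup_gen.mult)
  qed
  moreover have "{1..n} - ({1..n} - A) = A" using assms by blast
  ultimately show ?thesis by (metis Diff_subset finite_Diff finite_atLeastAtMost)
qed

lemma generated_iso_sym: "generated_iso n A f g B \<Longrightarrow> generated_iso n B g f A"
  unfolding generated_iso_def using fence_iso_sym by blast

lemma generated_iso_trans:
  assumes "generated_iso n A f g B" "generated_iso n B h k C"
  shows "generated_iso n A (h \<circ> f) (g \<circ> k) C"
proof -
  have 1: "fence_iso n A f g B" "fence_iso n B h k C"
    using assms unfolding generated_iso_def by blast+
  have "full_map (h \<circ> f) A = full_map f A \<cdot>\<^sub>p full_map h B"
    using fence_isoD(3)[OF 1(1)] by (simp add: pmult_full_map)
  moreover have "full_map (g \<circ> k) C = full_map k C \<cdot>\<^sub>p full_map g B"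
    using fence_isoD(3)[OF fence_iso_sym[OF 1(2)]] by (simp add: pmult_full_map)
  ultimately show ?thesis
    using assms fence_iso_trans[OF 1] unfolding generated_iso_def
    by (simp add: semigroup_gen.mult)
qed

lemma generated_iso_cong:
  assumes "generated_iso n A f g B" "\<And>x. x \<in> A \<Longrightarrow> f' x = f x" "\<And>x. x \<in> B \<Longrightarrow> g' x = g x"
  shows "generated_iso n A f' g' B"
proof -
  have "fence_iso n A f' g' B"
  proof -
    have iso: "A \<subseteq> {1..n}" "B \<subseteq> {1..n}" "f ` A = B" "\<And>x. x \<in> A \<Longrightarrow> g (f x) = x"
      "\<And>x y. x \<in> A \<Longrightarrow> y \<in> A \<Longrightarrow> fence_less n x y \<longleftrightarrow> fence_less n (f x) (f y)"
      using assms(1) unfolding generated_iso_def fence_iso_def by blast+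
    then have "f' ` A = B" "\<And>x. x \<in> A \<Longrightarrow> g' (f' x) = x"
      using assms(2,3) by force+
    then show ?thesis unfolding fence_iso_def using iso assms(2) by simp
  qed
  moreover have "full_map f' A = full_map f A" "full_map g' B = full_map g B"
    using assms(2,3) by (auto intro: full_map_cong)
  ultimately show ?thesis using assms(1) by (simp add: generated_iso_def)
qed

lemma generated_iso_id: "A \<subseteq> {1..n} \<Longrightarrow> generated_iso n A id id A"
  by (simp add: generated_iso_def fence_iso_id full_map_id_generated)

text \<open>Cutting a map of high rank down to a smaller domain amounts to multiplying it on the
  left by a partial identity; the same works for its inverse.\<close>

lemma generated_iso_restrict:
  assumes iso: "fence_iso n D f g E" and card: "int (card D) \<ge> int n - 2" and "A \<subseteq> D"
  shows "generated_iso n A f g (f ` A)"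
proof -
  have DE: "D \<subseteq> {1..n}" "E \<subseteq> {1..n}" "f ` D = E" "\<And>x. x \<in> D \<Longrightarrow> g (f x) = x"
    using iso unfolding fence_iso_def by blast+
  have "card E = card D" using DE(3,4) by (metis card_image inj_on_inverseI)
  then have "full_map g E \<in> semigroup_gen (IF_top n)"
    using fence_iso_top[OF fence_iso_sym[OF iso]] card by simp
  moreover have "full_map f D \<in> semigroup_gen (IF_top n)" by (rule fence_iso_top[OF iso card])
  moreover have "full_map f A = full_map id A \<cdot>\<^sub>p full_map f D"
    "full_map g (f ` A) = full_map id (f ` A) \<cdot>\<^sub>p full_map g E"
    using \<open>A \<subseteq> D\<close> DE(3) by (simp_all add: pmult_full_map image_mono flip: DE(3))
  moreover have "full_map id A \<in> semigroup_gen (IF_top n)" "full_map id (f ` A) \<in> semigroup_gen (IF_top n)"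
    using \<open>A \<subseteq> D\<close> DE(1-3) by (blast intro: full_map_id_generated)+
  moreover have "fence_iso n A f g (f ` A)"
    using iso \<open>A \<subseteq> D\<close> unfolding fence_iso_def by blast
  ultimately show ?thesis by (simp add: generated_iso_def semigroup_gen.mult)
qed

section \<open>Moves: reversing a block, shifting an isolated point\<close>

definition reflect :: "nat \<Rightarrow> nat \<Rightarrow> nat \<Rightarrow> nat" where
  "reflect a b x = (if a < x \<and> x < b then a + b - x else x)"

lemma reflect_reflect [simp]: "reflect a b (reflect a b x) = x"
  by (auto simp: reflect_def)

lemma mem_reflect_image: "y \<in> reflect a b ` A \<longleftrightarrow> reflect a b y \<in> A"
  by (metis image_iff reflect_reflect)

lemma reflect_image_run:
  assumes "s \<le> a"
  shows "reflect s b ` {a<..<b} = {s<..<s + b - a}"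
  using assms by (auto simp: set_eq_iff mem_reflect_image) (auto simp: reflect_def split: if_splits)

text \<open>As \<open>a + b\<close> is even, the reversal preserves parity, and with
  \<open>a\<close> and \<open>b\<close> removed no point inside the block is consecutive to one
  outside. The ends may be the outer separators \<open>0\<close> and \<open>n + 1\<close>.\<close>

lemma fence_less_reflect:
  assumes "x \<in> {1..n} - {a, b}" "y \<in> {1..n} - {a, b}" "even (a + b)" "b \<le> n + 1"
  shows "fence_less n (reflect a b x) (reflect a b y) \<longleftrightarrow> fence_less n x y"
proof -
  have "reflect a b x \<in> {1..n}" "reflect a b y \<in> {1..n}"
    using assms by (auto simp: reflect_def)
  moreover have "even (reflect a b y) \<longleftrightarrow> even y"
    using assms(3) by (auto simp: reflect_def)
  moreover have "reflect a b y = reflect a b x + 1 \<or> reflect a b x = reflect a b y + 1 \<longleftrightarrow>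
      y = x + 1 \<or> x = y + 1"
    using assms(1,2) unfolding reflect_def by (simp split: if_splits) linarith
  ultimately show ?thesis using assms(1,2) unfolding fence_less_def by blast
qed

lemma generated_iso_reflect:
  assumes "A \<subseteq> {1..n}" "a \<notin> A" "b \<notin> A" "even (a + b)" "b \<le> n + 1"
  shows "generated_iso n A (reflect a b) (reflect a b) (reflect a b ` A)"
proof (rule generated_iso_restrict)
  let ?D = "{1..n} - {a, b}"
  have "reflect a b ` ?D \<subseteq> {1..n}"
    using assms(5) by (auto simp: reflect_def)
  then show "fence_iso n ?D (reflect a b) (reflect a b) (reflect a b ` ?D)"
    unfolding fence_iso_def using fence_less_reflect assms(4,5) by simp
  \<comment> \<open>The ends may coincide or lie outside \<open>{1..n}\<close>, so the number of
    points lost is only bounded above.\<close>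
  have "card {a, b} \<le> 2" by (simp add: card_insert_if)
  then show "int n - 2 \<le> int (card ?D)"
    using diff_card_le_card_Diff[of "{a,b}" "{1..n}"] by simp
  show "A \<subseteq> ?D" using assms by auto
qed

text \<open>The shift is by two so that parities survive and, when \<open>a\<close> and
  \<open>a + 2\<close> are missing, \<open>2\<close> becomes vacant, which isolates the point
  arriving at \<open>1\<close>. The inverse is \<open>push\<close>.\<close>

definition pull :: "nat \<Rightarrow> nat \<Rightarrow> nat" where
  "pull a x = (if x < a then x + 2 else if x = a + 1 then 1 else x)"

definition push :: "nat \<Rightarrow> nat \<Rightarrow> nat" where
  "push a x = (if x = 1 then a + 1 else if 2 < x \<and> x < a + 2 then x - 2 else x)"

lemma fence_less_pull:
  assumes "x \<in> {1..n} - {a, a + 2}" "y \<in> {1..n} - {a, a + 2}" "a < n"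
  shows "fence_less n (pull a x) (pull a y) \<longleftrightarrow> fence_less n x y"
proof -
  have "pull a x \<in> {1..n}" "pull a y \<in> {1..n}"
    using assms by (auto simp: pull_def)
  moreover have "pull a y = pull a x + 1 \<or> pull a x = pull a y + 1 \<longleftrightarrow> y = x + 1 \<or> x = y + 1"
    using assms(1,2) unfolding pull_def by (simp split: if_splits)
  \<comment> \<open>Only consecutive pairs are sure to keep their parity; the isolated point may
    change its own.\<close>
  moreover have "even (pull a y) \<longleftrightarrow> even y" if "y = x + 1 \<or> x = y + 1"
    using assms(1,2) that unfolding pull_def by auto
  ultimately show ?thesis using assms(1,2) unfolding fence_less_def by blast
qed

lemma generated_iso_pull:
  assumes "A \<subseteq> {1..n}" "a \<notin> A" "a + 2 \<notin> A" "a < n"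
  shows "generated_iso n A (pull a) (push a) (pull a ` A)"
proof (rule generated_iso_restrict)
  let ?D = "{1..n} - {a, a + 2}"
  have "push a (pull a x) = x" if "x \<in> ?D" for x
    using that by (auto simp: pull_def push_def)
  moreover have "pull a ` ?D \<subseteq> {1..n}"
    using assms(4) by (auto simp: pull_def)
  ultimately show "fence_iso n ?D (pull a) (push a) (pull a ` ?D)"
    unfolding fence_iso_def using fence_less_pull assms(4) by simp
  show "int n - 2 \<le> int (card ?D)"
    using diff_card_le_card_Diff[of "{a,a+2}" "{1..n}"] by simp
  show "A \<subseteq> ?D" using assms by auto
qed

text \<open>Routing through position \<open>1\<close> takes the isolated point from
  \<open>a + 1\<close> to \<open>s + 1\<close>: the points before \<open>s\<close> go up by two and
  come back, those between \<open>s\<close> and \<open>a\<close> end two places higher.\<close>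

lemma generated_iso_pull_push:
  assumes "A \<subseteq> {1..n}" "s \<notin> A" "a \<notin> A" "a + 2 \<notin> A" "s \<le> a" "a < n"
  shows "generated_iso n A (push s \<circ> pull a) (push a \<circ> pull s) ((push s \<circ> pull a) ` A)"
proof -
  let ?B = "(push s \<circ> pull a) ` A"
  have pos: "x \<noteq> 0" "x \<noteq> s" "x \<noteq> a" "x \<noteq> a + 2" "x \<le> n" if "x \<in> A" for x
    using assms that by auto
  have inv: "pull s (push s (pull a x)) = pull a x" if "x \<in> A" for x
    using pos[OF that] assms(5) unfolding pull_def push_def by (simp split: if_splits)
  have "push s (pull a x) \<in> {1..n} - {s, s + 2}" if "x \<in> A" for x
    using pos[OF that] assms(5,6) unfolding pull_def push_def by auto
  then have "?B \<subseteq> {1..n} - {s, s + 2}" by auto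
  \<comment> \<open>Here \<open>push s\<close> is obtained as the inverse of the move
    \<open>pull s\<close> on \<open>?B\<close>, which misses \<open>s\<close> and
    \<open>s + 2\<close>.\<close>
  then have "generated_iso n ?B (pull s) (push s) (pull s ` ?B)"
    using assms by (intro generated_iso_pull) auto
  moreover have "pull s ` ?B = pull a ` A"
    using inv by (force simp: image_image)
  ultimately have "generated_iso n (pull a ` A) (push s) (pull s) ?B"
    using generated_iso_sym by metis
  with generated_iso_pull[OF assms(1,3,4,6)] show ?thesis
    by (rule generated_iso_trans)
qed

section \<open>Images of maximal runs\<close>

lemma fence_iso_adjacent:
  assumes "fence_iso n A f g B" "x \<in> A" "y \<in> A"
  shows "f y = f x + 1 \<or> f x = f y + 1 \<longleftrightarrow> y = x + 1 \<or> x = y + 1"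
proof -
  have *: "y = x + 1 \<or> x = y + 1 \<longleftrightarrow> fence_less n x y \<or> fence_less n y x"
    if "x \<in> {1..n}" "y \<in> {1..n}" for x y
    using that unfolding fence_less_def by auto
  note D = fence_isoD[OF assms(1)]
  have "f x \<in> {1..n}" "f y \<in> {1..n}" "x \<in> {1..n}" "y \<in> {1..n}"
    using D(1-3) assms(2,3) by blast+
  then show ?thesis using * D(5) assms(2,3) by simp
qed

text \<open>Of two consecutive points the even one lies on top, so preserving the order of the pair
  preserves parity. An isolated point has no such constraint.\<close>

lemma fence_iso_parity:
  assumes "fence_iso n A f g B" "x \<in> A" "x + 1 \<in> A"
  shows "even (f x) \<longleftrightarrow> even x"
proof -
  note D = fence_isoD[OF assms(1)]
  have "f x \<in> {1..n}" "f (x + 1) \<in> {1..n}" "x \<in> {1..n}" "x + 1 \<in> {1..n}"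
    using D(1-3) assms(2,3) by blast+
  moreover have "fence_less n (f x) (f (x + 1)) \<longleftrightarrow> fence_less n x (x + 1)"
    using D(5) assms by blast
  moreover have "f (x + 1) = f x + 1 \<or> f x = f (x + 1) + 1"
    using fence_iso_adjacent[OF assms] by simp
  ultimately show ?thesis unfolding fence_less_def by auto
qed

text \<open>Serves to show that the image of a maximal run is again maximal.\<close>

lemma fence_iso_neighbour:
  assumes "fence_iso n A f g B" "x \<in> A" "y \<in> B" "y = f x + 1 \<or> f x = y + 1"
  shows "(x + 1 \<in> A \<and> f (x + 1) = y) \<or> (x - 1 \<in> A \<and> 0 < x \<and> f (x - 1) = y)"
proof -
  obtain z where z: "z \<in> A" "f z = y" using fence_isoD(3)[OF assms(1)] assms(3) by blast
  then have "z = x + 1 \<or> x = z + 1"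
    using fence_iso_adjacent[OF assms(1,2)] assms(4) by blast
  with z show ?thesis by auto
qed

text \<open>Consecutive points have consecutive images and injectivity forbids turning back, so the
  run is translated or reversed. A point of \<open>B\<close> just beyond the image would come from a
  neighbour of an end of the run, but each such neighbour is missing from \<open>A\<close> or is
  mapped to the inner side.\<close>

lemma fence_iso_run_image:
  assumes iso: "fence_iso n A f g B" and s: "s \<notin> A" and t: "t \<notin> A"
    and run: "{s<..<t} \<subseteq> A" and st: "s + 1 < t"
  obtains a b where "a \<notin> B" "b \<notin> B" "b + s = a + t" "f ` {s<..<t} = {a<..<b}"
    "(\<forall>x\<in>{s<..<t}. f x + s = a + x) \<or> (\<forall>x\<in>{s<..<t}. f x + x = a + t)"
proof -
  note D = fence_isoD[OF iso]
  have inj: "f x = f y \<Longrightarrow> x = y" if "x \<in> A" "y \<in> A" for x y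
    using D(4) that by metis
  have pos: "0 < f x" if "x \<in> A" for x using D(2,3) that by force
  have mem: "x \<in> A" if "s < x" "x < t" for x using run that by auto
  have adj: "f (x + 1) = f x + 1 \<or> f x = f (x + 1) + 1" if "s < x" "x + 1 < t" for x
    using fence_iso_adjacent[OF iso, of x "x + 1"] mem that by simp
  \<comment> \<open>Since \<open>s\<close> is missing, only \<open>s + 2\<close> can supply a
    neighbour of \<open>f (s + 1)\<close>; likewise only \<open>t - 2\<close> at the other
    end.\<close>
  have first: "f (s + 2) = y" if "y \<in> B" "y = f (s + 1) + 1 \<or> f (s + 1) = y + 1" for y
    using fence_iso_neighbour[OF iso mem[of "s + 1"] that] st s by (simp add: numeral_2_eq_2)
  have first': "s + 2 < t" if "y \<in> B" "y = f (s + 1) + 1 \<or> f (s + 1) = y + 1" for y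
    using fence_iso_neighbour[OF iso mem[of "s + 1"] that] st s t
    by (auto simp: numeral_2_eq_2 nat_less_le Suc_le_eq)
  have last: "f (t - 2) = y \<and> s < t - 2" if "y \<in> B" "y = f (t - 1) + 1 \<or> f (t - 1) = y + 1" for y
  proof -
    have "t - 2 \<in> A \<and> f (t - 2) = y"
      using fence_iso_neighbour[OF iso mem[of "t - 1"] that] st t
      by (auto simp: numeral_2_eq_2)
    moreover from this have "t - 2 \<noteq> s" using s by blast
    ultimately show ?thesis using st by simp
  qed
  show ?thesis
  \<comment> \<open>The first step decides the direction; a run of a single point counts as
    ascending.\<close>
  proof (cases "s + 2 < t \<longrightarrow> f (s + 2) = f (s + 1) + 1")
    case up: True
    have step: "s + 1 + Suc k < t \<Longrightarrow> f (s + 1 + Suc k) = f (s + 1 + k) + 1" for k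
    proof (induction k)
      case 0
      then show ?case using up by simp
    next
      case (Suc k)
      have "f (s + 1 + k) \<noteq> f (s + 1 + Suc (Suc k))"
        using inj[OF mem mem, of "s + 1 + k" "s + 1 + Suc (Suc k)"] Suc.prems by auto
      then show ?case using adj[of "s + 1 + Suc k"] Suc by simp
    qed
    have val: "s + 1 + k < t \<Longrightarrow> f (s + 1 + k) = f (s + 1) + k" for k
    proof (induction k)
      case (Suc k)
      then show ?case using step[of k] by simp
    qed simp
    \<comment> \<open>The two positions just outside the image. All values are positive, so the
      subtraction is exact.\<close>
    define a where "a = f (s + 1) - 1"
    define b where "b = a + t - s"
    have a: "f (s + 1) = a + 1" using pos[OF mem, of "s + 1"] st by (simp add: a_def)
    have val': "f x + s = a + x" if "s < x" "x < t" for x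
      using val[of "x - s - 1"] that a by simp
    have "a \<notin> B" using first[of a] first'[of a] val'[of "s + 2"] a by auto
    moreover have "b \<notin> B"
    proof
      assume "b \<in> B"
      moreover have "s < t - 1" "t - 1 < t" using st by auto
      then have "b = f (t - 1) + 1" using val'[of "t - 1"] by (simp add: b_def)
      ultimately have "f (t - 2) = b" "s < t - 2" using last[of b] by blast+
      with val'[of "t - 2"] show False by (simp add: b_def)
    qed
    moreover have "b + s = a + t" using st by (simp add: b_def)
    moreover have "f ` {s<..<t} = {a<..<b}"
    proof (intro set_eqI iffI)
      fix y assume "y \<in> {a<..<b}"
      then have "y = f (y + s - a)" "y + s - a \<in> {s<..<t}"
        using val'[of "y + s - a"] by (auto simp: b_def)
      then show "y \<in> f ` {s<..<t}" by blast
    next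
      fix y assume "y \<in> f ` {s<..<t}"
      then show "y \<in> {a<..<b}" using val' by (fastforce simp: b_def)
    qed
    ultimately show ?thesis using that val' by simp
  next
    case down: False
    have step: "s + 1 + Suc k < t \<Longrightarrow> f (s + 1 + k) = f (s + 1 + Suc k) + 1" for k
    proof (induction k)
      case 0
      then show ?case using down adj[of "s + 1"] by simp
    next
      case (Suc k)
      have "f (s + 1 + k) \<noteq> f (s + 1 + Suc (Suc k))"
        using inj[OF mem mem, of "s + 1 + k" "s + 1 + Suc (Suc k)"] Suc.prems by auto
      then show ?case using adj[of "s + 1 + Suc k"] Suc by simp
    qed
    have val: "s + 1 + k < t \<Longrightarrow> f (s + 1 + k) + k = f (s + 1)" for k
    proof (induction k)
      case (Suc k)
      then show ?case using step[of k] by simp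
    qed simp
    \<comment> \<open>In a descending run the least value is taken at the last point
      \<open>t - 1\<close>.\<close>
    define a where "a = f (t - 1) - 1"
    define b where "b = a + t - s"
    have a: "f (t - 1) = a + 1" using pos[OF mem, of "t - 1"] st by (simp add: a_def)
    have "s + 1 + (t - s - 2) = t - 1" "t - 1 < t" using st by auto
    then have "f (t - 1) + (t - s - 2) = f (s + 1)" using val by metis
    then have val': "f x + x = a + t" if "s < x" "x < t" for x
      using val[of "x - s - 1"] that a by simp
    have "b \<notin> B"
    proof
      assume "b \<in> B"
      moreover have "b = f (s + 1) + 1" using val'[of "s + 1"] st by (simp add: b_def)
      ultimately have "f (s + 2) = b" "s + 2 < t" using first[of b] first'[of b] by blast+
      with val'[of "s + 2"] show False by (simp add: b_def)
    qed
    moreover have "a \<notin> B"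
      using last[of a] a val'[of "t - 2"] st by auto
    moreover have "b + s = a + t" using st by (simp add: b_def)
    moreover have "f ` {s<..<t} = {a<..<b}"
    proof (intro set_eqI iffI)
      fix y assume "y \<in> {a<..<b}"
      then have "s < a + t - y" "a + t - y < t" "y \<le> a + t" using st by (auto simp: b_def)
      moreover from this have "y = f (a + t - y)" using val'[of "a + t - y"] by simp
      ultimately have "y = f (a + t - y)" "a + t - y \<in> {s<..<t}" by simp_all
      then show "y \<in> f ` {s<..<t}" by blast
    next
      fix y assume "y \<in> f ` {s<..<t}"
      then show "y \<in> {a<..<b}" using val' by (fastforce simp: b_def)
    qed
    ultimately show ?thesis using that val' by simp
  qed
qed

section \<open>Maps fixing everything below a separator\<close>

lemma fence_iso_generated_cong:
  assumes iso: "fence_iso n A f g B" and gen: "generated_iso n A f' g' B'"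
    and eq: "\<And>x. x \<in> A \<Longrightarrow> f x = f' x"
  shows "generated_iso n A f g B"
proof -
  have iso': "fence_iso n A f' g' B'" using gen by (simp add: generated_iso_def)
  note D = fence_isoD[OF iso] and D' = fence_isoD[OF iso']
  have "B' = B" unfolding D(3)[symmetric] D'(3)[symmetric] using eq by (simp cong: image_cong)
  moreover have "g y = g' y" if "y \<in> B" for y
  proof -
    have "y \<in> f ` A" using that D(3) by simp
    then obtain x where "x \<in> A" "y = f x" by blast
    then show ?thesis using D(4) D'(4) eq by metis
  qed
  ultimately show ?thesis using gen eq by (auto intro: generated_iso_cong)
qed

text \<open>The invariant of the induction: everything before \<open>s\<close> is settled and
  nothing after \<open>s\<close> is sent back across it. For \<open>s = 0\<close> it holds for every
  map between subsets of \<open>{1..n}\<close>.\<close>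

definition keeps_separator :: "nat \<Rightarrow> nat set \<Rightarrow> (nat \<Rightarrow> nat) \<Rightarrow> bool" where
  "keeps_separator s A f \<longleftrightarrow> s \<notin> A \<and> (\<forall>x\<in>A. x < s \<longrightarrow> f x = x) \<and> (\<forall>x\<in>A. s < x \<longrightarrow> s < f x)"

lemma keeps_separator_image: "keeps_separator s A f \<Longrightarrow> s \<notin> f ` A"
  unfolding keeps_separator_def by (metis image_iff linorder_neqE_nat nat_neq_iff)

lemma keeps_separator_comp:
  assumes "keeps_separator s A f" "keeps_separator s (f ` A) h"
  shows "keeps_separator s A (h \<circ> f)"
  using assms unfolding keeps_separator_def by force

lemma keeps_separator_sym:
  assumes "fence_iso n A f g B" "keeps_separator s A f"
  shows "keeps_separator s B g"
proof -
  note D = fence_isoD[OF assms(1)]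
  have "s \<notin> B" using keeps_separator_image[OF assms(2)] D(3) by blast
  moreover have "(y < s \<longrightarrow> g y = y) \<and> (s < y \<longrightarrow> s < g y)" if "y \<in> B" for y
  proof -
    have "y \<in> f ` A" using that D(3) by simp
    then obtain x where x: "x \<in> A" "y = f x" by blast
    then have "g y = x" using D(4) by blast
    then show ?thesis
      using x assms(2) unfolding keeps_separator_def by (metis linorder_neqE_nat order_less_asym)
  qed
  ultimately show ?thesis unfolding keeps_separator_def by blast
qed

text \<open>Position and parity decide the move: a run in place needs none, a single point is
  shifted, one reversal between \<open>s\<close> and \<open>b\<close> works when their parities
  agree, and otherwise a separator \<open>u\<close> of the other parity allows two
  reversals.\<close>

lemma bring_run_to_front:
  assumes B: "B \<subseteq> {1..n}" and seps: "s \<notin> B" "a \<notin> B" "b \<notin> B"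
    and le: "s \<le> a" "a + 1 < b" "b \<le> n + 1"
    and cases: "a = s \<or> b = a + 2 \<or> even (b + s) \<or> (\<exists>u. u \<notin> B \<and> s < u \<and> u < a \<and> odd (u + s) \<and> even (a + s) \<and> even (u + b))"
  obtains h h' C where "generated_iso n B h h' C" "keeps_separator s B h"
    "h ` {a<..<b} = {s<..<s + b - a}"
proof -
  have reflect_keeps: "keeps_separator s C (reflect s' c)" if "s \<notin> C" "s \<le> s'" for C s' c
    using that unfolding keeps_separator_def by (auto simp: reflect_def)
  consider "a = s" | "b = a + 2" | "even (b + s)"
    | u where "u \<notin> B" "s < u" "u < a" "odd (u + s)" "even (a + s)" "even (u + b)"
    using cases by blast
  then show ?thesis
  proof cases
    case 1
    show ?thesis
      by (rule that[OF generated_iso_id[OF B]]) (use seps 1 in \<open>auto simp: keeps_separator_def\<close>)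
  next
    case 2
    have "generated_iso n B (push s \<circ> pull a) (push a \<circ> pull s) ((push s \<circ> pull a) ` B)"
      using B seps le 2 by (intro generated_iso_pull_push) auto
    moreover have "keeps_separator s B (push s \<circ> pull a)"
      unfolding keeps_separator_def
    proof (intro conjI ballI impI)
      fix x assume "x \<in> B" "x < s"
      moreover from this have "x \<noteq> 0" using B by auto
      ultimately show "(push s \<circ> pull a) x = x" using le by (auto simp: pull_def push_def)
    next
      fix x assume "x \<in> B" "s < x"
      moreover from this have "x \<noteq> a" "x \<noteq> a + 2" using seps 2 by auto
      ultimately show "s < (push s \<circ> pull a) x" using le by (auto simp: pull_def push_def)
    qed (rule seps)
    moreover have "{a<..<b} = {a + 1}" "{s<..<s + b - a} = {s + 1}"
      using 2 le by auto
    ultimately show ?thesis using that by (simp add: pull_def push_def)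
  next
    case 3
    have "generated_iso n B (reflect s b) (reflect s b) (reflect s b ` B)"
      using B seps le 3 by (intro generated_iso_reflect) (auto simp: add.commute)
    then show ?thesis
      using that reflect_keeps[OF seps(1) order_refl] reflect_image_run[OF le(1)] by blast
  next
    case 4
    \<comment> \<open>The first reversal, between \<open>u\<close> and \<open>b\<close>, carries the
      separator \<open>a\<close> to \<open>c\<close>. The parity of \<open>c\<close> permits a
      second reversal, between \<open>s\<close> and \<open>c\<close>, which takes the run from just
      after \<open>u\<close> to just after \<open>s\<close>.\<close>
    define c where "c = u + b - a"
    have c: "u < c" "c < b" "even (s + c)" using 4 le by (auto simp: c_def)
    have B1: "generated_iso n B (reflect u b) (reflect u b) (reflect u b ` B)"
      using B seps le 4 by (intro generated_iso_reflect) auto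
    then have "reflect u b ` B \<subseteq> {1..n}"
      unfolding generated_iso_def by (blast dest: fence_isoD(2))
    moreover have s: "s \<notin> reflect u b ` B"
      unfolding mem_reflect_image using seps 4 by (simp add: reflect_def)
    moreover have "c \<notin> reflect u b ` B"
    proof -
      have "reflect u b c = a" using c 4 le by (simp add: reflect_def c_def)
      then show ?thesis using seps by (simp add: mem_reflect_image)
    qed
    ultimately have "generated_iso n (reflect u b ` B) (reflect s c) (reflect s c)
        (reflect s c ` reflect u b ` B)"
      using c le by (intro generated_iso_reflect) auto
    note generated_iso_trans[OF B1 this]
    moreover have "keeps_separator s B (reflect s c \<circ> reflect u b)"
      using 4 s seps by (intro keeps_separator_comp reflect_keeps) auto
    moreover have "(reflect s c \<circ> reflect u b) ` {a<..<b} = {s<..<s + b - a}"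
    proof -
      have "reflect u b ` {a<..<b} = {u<..<c}"
        using 4 reflect_image_run[of u a b] by (simp add: c_def)
      moreover have "reflect s c ` {u<..<c} = {s<..<s + b - a}"
        using 4 le reflect_image_run[of s u c] by (simp add: c_def)
      ultimately show ?thesis by (metis image_comp)
    qed
    ultimately show ?thesis by (rule that)
  qed
qed

text \<open>Once \<open>h\<close> has put the image of the run back between \<open>s\<close> and
  \<open>t\<close>, at most one more reversal fixes the run pointwise. The composite then keeps
  \<open>t\<close>, so \<open>rec\<close> applies, and \<open>f\<close> is recovered by composing
  with the inverse moves.\<close>

lemma fix_run_and_recurse:
  assumes iso: "fence_iso n A f g B" and keep: "keeps_separator s A f"
    and t: "t \<notin> A" "t \<le> n + 1" and run: "{s<..<t} \<subseteq> A" and st: "s + 1 < t"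
    and h: "generated_iso n B h h' C" "keeps_separator s B h" "h ` f ` {s<..<t} = {s<..<t}"
    and rec: "\<And>f g B. fence_iso n A f g B \<Longrightarrow> keeps_separator t A f \<Longrightarrow> generated_iso n A f g B"
  shows "generated_iso n A f g B"
proof -
  \<comment> \<open>Any generated \<open>k\<close> that keeps \<open>s\<close>, leaves
    \<open>t\<close> vacant and undoes \<open>f\<close> on the run lets the induction advance to
    \<open>t\<close>.\<close>
  have reduce: "generated_iso n A f g B"
    if k: "generated_iso n B k k' D" "keeps_separator s B k"
      and fixed: "\<And>x. x \<in> {s<..<t} \<Longrightarrow> k (f x) = x" and tD: "t \<notin> D" for k k' D
  proof -
    have iso2: "fence_iso n A (k \<circ> f) (g \<circ> k') D"
      using fence_iso_trans[OF iso] k(1) unfolding generated_iso_def by blast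
    note E = fence_isoD[OF iso2]
    have keep2: "keeps_separator s A (k \<circ> f)"
      using keeps_separator_comp[OF keep] k(2) fence_isoD(3)[OF iso] by simp
    have "t < (k \<circ> f) x" if x: "x \<in> A" "t < x" for x
    proof -
      have "(k \<circ> f) x \<noteq> t" using E(3) tD x(1) by blast
      moreover have "s < (k \<circ> f) x"
        using keep2 x st unfolding keeps_separator_def by simp
      \<comment> \<open>The places of the run are taken by its own fixed points, so injectivity bars
        \<open>x\<close> from them.\<close>
      moreover have "\<not> (k \<circ> f) x < t"
      proof
        let ?y = "(k \<circ> f) x"
        assume "?y < t"
        then have y: "?y \<in> {s<..<t}" using \<open>s < ?y\<close> by simp
        then have "(k \<circ> f) ?y = ?y" using fixed by simp
        then have "?y = x" using E(4) y x(1) run by (metis subsetD)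
        then show False using \<open>?y < t\<close> x(2) by simp
      qed
      ultimately show ?thesis by simp
    qed
    moreover have "(k \<circ> f) x = x" if "x \<in> A" "x < t" for x
    proof (cases "s < x")
      case True
      then show ?thesis using fixed that by simp
    next
      case False
      moreover have "x \<noteq> s" using keep that unfolding keeps_separator_def by blast
      ultimately show ?thesis using keep2 that unfolding keeps_separator_def by simp
    qed
    ultimately have "keeps_separator t A (k \<circ> f)"
      using t(1) unfolding keeps_separator_def by blast
    from generated_iso_trans[OF rec[OF iso2 this] generated_iso_sym[OF k(1)]]
    show ?thesis
    proof (rule fence_iso_generated_cong[OF iso])
      fix x assume "x \<in> A"
      then have "f x \<in> B" using fence_isoD(3)[OF iso] by blast
      then show "f x = (k' \<circ> (k \<circ> f)) x"
        using k(1) fence_isoD(4) unfolding generated_iso_def by fastforce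
    qed
  qed
  have iso1: "fence_iso n A (h \<circ> f) (g \<circ> h') C"
    using fence_iso_trans[OF iso] h(1) unfolding generated_iso_def by blast
  have "s \<notin> A" using keep unfolding keeps_separator_def by blast
  then obtain a b where ab: "a \<notin> C" "b \<notin> C" "b + s = a + t" "(h \<circ> f) ` {s<..<t} = {a<..<b}"
    "(\<forall>x\<in>{s<..<t}. (h \<circ> f) x + s = a + x) \<or> (\<forall>x\<in>{s<..<t}. (h \<circ> f) x + x = a + t)"
    using fence_iso_run_image[OF iso1 _ t(1) run st] by blast
  have "{a<..<b} = {s<..<t}" using ab(4) h(3) by (simp add: image_comp)
  \<comment> \<open>Equal nonempty open intervals have the same left end.\<close>
  moreover have "a + 1 \<in> {a<..<b}" "s + 1 \<in> {s<..<t}" using ab(3) st by auto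
  ultimately have "a + 1 \<in> {s<..<t}" "s + 1 \<in> {a<..<b}" by blast+
  then have "a = s" by simp
  then have "b = t" using ab(3) by simp
  from ab(5) consider "\<And>x. x \<in> {s<..<t} \<Longrightarrow> h (f x) = x"
    | "\<And>x. x \<in> {s<..<t} \<Longrightarrow> h (f x) + x = s + t" using \<open>a = s\<close> by auto
  then show ?thesis
  proof cases
    case 1
    then show ?thesis using reduce[OF h(1,2)] ab(2) \<open>b = t\<close> by blast
  next
    case 2
    \<comment> \<open>A reversal sends \<open>s + 1\<close> to \<open>t - 1\<close>. If
      \<open>s + t\<close> were odd, the run would have even length, hence at least two points, and
      parity would be preserved, a contradiction.\<close>
    have even: "even (s + t)"
    proof (rule ccontr)
      assume odd: "odd (s + t)"
      then have "s + 2 < t" using st by (metis Suc_1 Suc_lessI add_Suc_right even_add odd_one Suc_eq_plus1 even_Suc)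
      then have "s + 1 \<in> A" "s + 1 + 1 \<in> A" using run by auto
      then have "even ((h \<circ> f) (s + 1)) \<longleftrightarrow> even (s + 1)" by (rule fence_iso_parity[OF iso1])
      moreover have "h (f (s + 1)) + 1 = t" using 2[of "s + 1"] st by simp
      ultimately show False using odd by (auto simp: comp_def)
    qed
    have C: "C \<subseteq> {1..n}" using fence_isoD(2)[OF iso1] .
    have st': "s \<notin> C" "t \<notin> C" using ab \<open>a = s\<close> \<open>b = t\<close> by simp_all
    have refl: "generated_iso n C (reflect s t) (reflect s t) (reflect s t ` C)"
      using generated_iso_reflect[OF C st' even t(2)] .
    show ?thesis
    proof (rule reduce[OF generated_iso_trans[OF h(1) refl]])
      have "h ` B = C" using h(1) unfolding generated_iso_def by (blast dest: fence_isoD(3))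
      moreover have "keeps_separator s C (reflect s t)"
        using st' unfolding keeps_separator_def by (auto simp: reflect_def)
      ultimately show "keeps_separator s B (reflect s t \<circ> h)"
        using keeps_separator_comp h(2) by blast
      show "(reflect s t \<circ> h) (f x) = x" if "x \<in> {s<..<t}" for x
        using 2[OF that] that by (auto simp: reflect_def)
      show "t \<notin> reflect s t ` C" 
        unfolding mem_reflect_image using st' by (simp add: reflect_def)
    qed
  qed
qed

section \<open>Induction over the separators\<close>

lemma next_separator:
  assumes "A \<subseteq> {1..n}" "s \<le> n"
  obtains t :: nat where "s < t" "t \<le> n + 1" "t \<notin> A" "{s<..<t} \<subseteq> A"
proof -
  define t where "t = (LEAST t. s < t \<and> t \<notin> A)"
  have n: "s < n + 1 \<and> n + 1 \<notin> A" using assms by auto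
  have "s < t \<and> t \<notin> A" unfolding t_def using n by (rule LeastI)
  moreover have "t \<le> n + 1" unfolding t_def using n by (rule Least_le)
  moreover have "x \<in> A" if "s < x" "x < t" for x
    using not_less_Least[of x "\<lambda>t. s < t \<and> t \<notin> A"] that by (auto simp: t_def)
  then have "{s<..<t} \<subseteq> A" by auto
  ultimately show ?thesis using that by blast
qed

text \<open>Induction on the distance from \<open>s\<close> to \<open>n\<close>: each round settles
  one more run or skips a place that is vacant on both sides.\<close>

lemma fence_iso_generated:
  assumes "fence_iso n A f g B" "keeps_separator s A f"
  shows "generated_iso n A f g B"
  using assms
proof (induction "n - s" arbitrary: s A f g B rule: less_induct)
  case less
  note D = fence_isoD[OF less.prems(1)]
  show ?case
  proof (cases "s < n")
    \<comment> \<open>No point of \<open>A\<close> lies beyond \<open>s\<close>, so the map is the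
      identity on \<open>A\<close>.\<close>
    case False
    have "f x = id x" if "x \<in> A" for x
    proof -
      have "x \<le> n" "x \<noteq> s" using that D(1) less.prems(2) unfolding keeps_separator_def by auto
      then show ?thesis using False that less.prems(2) unfolding keeps_separator_def by simp
    qed
    then show ?thesis
      by (rule fence_iso_generated_cong[OF less.prems(1) generated_iso_id[OF D(1)]])
  next
    case True
    \<comment> \<open>Stated for arbitrary sets and maps so that it also covers the inverse. The
      next separators of \<open>A\<close> and \<open>B\<close> are \<open>t\<close> and
      \<open>u\<close>; \<open>par\<close> asks that the run of \<open>A\<close> have odd length or
      the initial block of \<open>B\<close> even length.\<close>
    have step: "generated_iso n A f g B"
      if iso: "fence_iso n A f g B" and keep: "keeps_separator s A f"
        and t: "t \<le> n + 1" "t \<notin> A" "{s<..<t} \<subseteq> A" "s + 1 < t"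
        and u: "u \<notin> B" "{s<..<u} \<subseteq> B" "s < u"
        and par: "even (s + t) \<or> odd (s + u)" for A f g B t u
    proof -
      note D = fence_isoD[OF iso]
      have s: "s \<notin> A" "s \<notin> B"
        using keep keeps_separator_sym[OF iso keep] unfolding keeps_separator_def by blast+
      obtain a b where ab: "a \<notin> B" "b \<notin> B" "b + s = a + t" "f ` {s<..<t} = {a<..<b}"
        "(\<forall>x\<in>{s<..<t}. f x + s = a + x) \<or> (\<forall>x\<in>{s<..<t}. f x + x = a + t)"
        using fence_iso_run_image[OF iso s(1) t(2-4)] by blast
      have len: "a + 1 < b" using ab(3) t(4) by simp
      have run: "{a<..<b} \<subseteq> B" using ab(4) D(3) t(3) by blast
      have "s \<le> a"
      proof -
        have "a + 1 \<in> f ` {s<..<t}" using ab(4) len by simp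
        then obtain x where "x \<in> A" "s < x" "f x = a + 1" using t(3) by auto
        then show ?thesis using keep unfolding keeps_separator_def by fastforce
      qed
      have "b - 1 \<in> {1..n}" using run len D(2) by fastforce
      then have "b \<le> n + 1" by auto
      have "a = s \<or> b = a + 2 \<or> even (b + s) \<or>
          (\<exists>u. u \<notin> B \<and> s < u \<and> u < a \<and> odd (u + s) \<and> even (a + s) \<and> even (u + b))"
      proof (cases "even (s + t)")
        case True
        \<comment> \<open>With two points or more, parity is preserved, and \<open>s + 1\<close>
          goes to an end of the image. For odd length both ends have the same parity, so
          \<open>b\<close> agrees with \<open>s\<close>.\<close>
        have "even (b + s)" if "t \<noteq> s + 2"
        proof -
          have "s + 1 \<in> A" "s + 1 + 1 \<in> A" using t(3,4) that by auto
          then have "even (f (s + 1)) \<longleftrightarrow> even (s + 1)" by (rule fence_iso_parity[OF iso])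
          moreover have "f (s + 1) = a + 1 \<or> f (s + 1) + 1 = b"
          proof -
            have "s + 1 \<in> {s<..<t}" using t(4) by simp
            with ab(5) have "f (s + 1) + s = a + (s + 1) \<or> f (s + 1) + (s + 1) = a + t" by blast
            then show ?thesis using ab(3) by linarith
          qed
          moreover have "even (b + a)" using True ab(3) by presburger
          ultimately show ?thesis by auto
        qed
        then show ?thesis using ab(3) by auto
      next
        case False
        \<comment> \<open>When \<open>b\<close> has the wrong parity, \<open>u\<close> is the
          intermediate separator: all points strictly between \<open>s\<close> and \<open>u\<close>
          lie in \<open>B\<close>, so \<open>a\<close> is not among them, and parity excludes
          \<open>a = u\<close>.\<close>
        have "u < a \<and> even (a + s) \<and> even (u + b)" if "odd (b + s)" "a \<noteq> s"
        proof -
          have "s < a" using that \<open>s \<le> a\<close> by simp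
          then have "u \<le> a" using u(2) ab(1) by (meson greaterThanLessThan_iff leI subsetD)
          moreover have "even (a + s)" using that False ab(3) by presburger
          ultimately show ?thesis using that par False by (auto simp: le_less)
        qed
        then show ?thesis using u par False by (auto simp: add.commute)
      qed
      with D(2) s(2) ab(1,2) \<open>s \<le> a\<close> len \<open>b \<le> n + 1\<close>
      obtain h h' C where h: "generated_iso n B h h' C" "keeps_separator s B h"
        "h ` {a<..<b} = {s<..<s + b - a}" by (rule bring_run_to_front)
      have "s + b - a = t" using ab(3) by simp
      then have "h ` f ` {s<..<t} = {s<..<t}" using h(3) ab(4) by simp
      moreover have "n - t < n - s" using t(4) True by simp
      ultimately show ?thesis
        by (intro fix_run_and_recurse[OF iso keep t(2,1,3,4) h(1,2)] less.hyps)
    qed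
    obtain t where t: "s < t" "t \<le> n + 1" "t \<notin> A" "{s<..<t} \<subseteq> A"
      using next_separator[OF D(1)] True by (metis less_imp_le)
    obtain u where u: "s < u" "u \<le> n + 1" "u \<notin> B" "{s<..<u} \<subseteq> B"
      using next_separator[OF D(2)] True by (metis less_imp_le)
    note sym = fence_iso_sym[OF less.prems(1)] keeps_separator_sym[OF less.prems]
    \<comment> \<open>A run of even length can be brought to the front only if the other side starts with a block of
      even length, possibly empty.  Exchanging the map with its inverse makes this always achievable.\<close>
    have "s + 1 < t \<and> (even (s + t) \<or> odd (s + u)) \<or> s + 1 < u \<and> (even (s + u) \<or> odd (s + t)) \<or>
        t = s + 1 \<and> u = s + 1"
      using t(1) u(1) by presburger
    then consider "s + 1 < t" "even (s + t) \<or> odd (s + u)" | "s + 1 < u" "even (s + u) \<or> odd (s + t)"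
      | "t = s + 1" "u = s + 1"
      by blast
    then show ?thesis
    proof cases
      case 1
      then show ?thesis using step[OF less.prems t(2-4) _ u(3,4,1)] by blast
    next
      case 2
      then show ?thesis using step[OF sym u(2-4) _ t(3,4,1)] generated_iso_sym by blast
    next
      case 3
      \<comment> \<open>The place \<open>s + 1\<close> is vacant on both sides and takes over as
        separator.\<close>
      have "keeps_separator (s + 1) A f"
        unfolding keeps_separator_def
      proof (intro conjI ballI impI)
        show "s + 1 \<notin> A" using t 3 by simp
        show "f x = x" if "x \<in> A" "x < s + 1" for x
          using that less.prems(2) unfolding keeps_separator_def by (metis Suc_eq_plus1 less_Suc_eq)
        show "s + 1 < f x" if "x \<in> A" "s + 1 < x" for x
        proof -
          have "f x \<in> B" using D(3) that by blast
          then have "f x \<noteq> s + 1" using u(3) 3 by metis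
          moreover have "s < f x" using that less.prems(2) unfolding keeps_separator_def by simp
          ultimately show ?thesis by simp
        qed
      qed
      then show ?thesis using less.hyps[of "s + 1"] less.prems(1) True by simp
    qed
  qed
qed

section \<open>From partial maps to generated isomorphisms\<close>

theorem theorem3p15:
  fixes n :: nat
  assumes "n \<ge> 1"
  shows "IF n = semigroup_gen {\<alpha> \<in> IF n. int (rank \<alpha>) \<ge> int n - 2}"
proof
  show "semigroup_gen {\<alpha> \<in> IF n. int (rank \<alpha>) \<ge> int n - 2} \<subseteq> IF n"
    using semigroup_gen_IF_top_subset unfolding IF_top_def .
  show "IF n \<subseteq> semigroup_gen {\<alpha> \<in> IF n. int (rank \<alpha>) \<ge> int n - 2}"
  proof
    fix \<alpha> assume "\<alpha> \<in> IF n"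
    then have \<alpha>: "dom \<alpha> \<subseteq> {1..n}" "ran \<alpha> \<subseteq> {1..n}" "inj_on \<alpha> (dom \<alpha>)"
      "\<forall>x\<in>dom \<alpha>. \<forall>y\<in>dom \<alpha>. fence_less n x y \<longleftrightarrow> fence_less n (the (\<alpha> x)) (the (\<alpha> y))"
      unfolding IF_def sym_inv_def by blast+
    \<comment> \<open>Outside the domain \<open>f\<close> has junk values, which
      \<open>full_map\<close> discards.\<close>
    define f where "f = (\<lambda>x. the (\<alpha> x))"
    have eq: "\<alpha> = full_map f (dom \<alpha>)"
      by (rule ext) (auto simp: full_map_def f_def)
    have "inj_on f (dom \<alpha>)"
      using \<alpha>(3) unfolding inj_on_def f_def by (metis domD option.sel)
    moreover have "f ` dom \<alpha> \<subseteq> {1..n}" using \<alpha>(2) eq by (metis ran_full_map)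
    ultimately have "fence_iso n (dom \<alpha>) f (inv_into (dom \<alpha>) f) (f ` dom \<alpha>)"
      unfolding fence_iso_def using \<alpha>(1,4) inv_into_f_f[of f] by (simp add: f_def)
    \<comment> \<open>The separator \<open>0\<close> starts the induction: no point lies below it
      and all values are positive.\<close>
    moreover have "keeps_separator 0 (dom \<alpha>) f"
      unfolding keeps_separator_def using \<alpha>(1) \<open>f ` dom \<alpha> \<subseteq> {1..n}\<close> by fastforce
    ultimately have "generated_iso n (dom \<alpha>) f (inv_into (dom \<alpha>) f) (f ` dom \<alpha>)"
      by (rule fence_iso_generated)
    then show "\<alpha> \<in> semigroup_gen {\<alpha> \<in> IF n. int (rank \<alpha>) \<ge> int n - 2}"
      using eq unfolding generated_iso_def IF_top_def by simp
  qed
qed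

end
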